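(* Let $F$ be a forest of size $n$. Then $$\sum_{w \in \mathcal{W}_B(F)} p^{n_1(F,w)}q^{\mathrm{inv}_B(F,w)} \prod_{v \in \mathrm{Btmax}_B(F,w)} t_v = \frac{n!}{\prod_{v \in V(F)} h_v} \prod_{v \in V(F)} \left((1+pq^{h_v})[h_v]-1+t_v\right).$$
   Context: $F$ is a finite rooted plane forest with vertex set $V(F)=\{v_1,\dots,v_n\}$, $n\ge 1$. It is drawn with roots on top and regarded as the Hasse diagram of the poset $(V(F),<_F)$: $u<_F v$ means that $u\ne v$ and $u$ is a descendant of $v$. The vertices are naturally indexed: $v_i<_F v_j$ implies $i<j$. For a vertex $v$, $h_v=\#\{u: u\le_F v\}$ is the number of vertices of the subtree rooted at $v$. $\mathcal{W}_B(F)$ is the set of signed labelings of $F$, i.e. injective maps $w:V(F)\to\{\pm1,\dots,\pm n\}$ such that $i\in w(V(F))$ implies $-i\notin w(V(F))$. For $w\in\mathcal{W}_B(F)$: $\mathrm{inv}(F,w)=\#\{(u,v):u<_F v,\ w(u)>w(v)\}$; $n_1(F,w)$ is the number of negative labels of $w$; $n_2(F,w)=\#\{(x,y):x<_F y,\ w(x)+w(y)<0\}$; $\mathrm{inv}_B(F,w)=\mathrm{inv}(F,w)+n_1(F,w)+n_2(F,w)$; and $\mathrm{Btmax}_B(F,w)=\{v: w(v)>0\text{ and }w(v)>|w(u)|\text{ for all }u<_F v\}$. $[m]=1+q+\cdots+q^{m-1}$; $p$, $q$ and $t_v$ ($v\in V(F)$) are commuting indeterminates. *)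

theory Defs
  imports Complex_Main "HOL-Library.FuncSet" "HOL-Library.Poly_Mapping"
begin

section \<open>Plane forests\<close>

text \<open>
  A plane forest is a list of plane trees whose vertices carry pairwise distinct names of
  type \<open>'a\<close>; the order of the lists is the left-to-right order of the roots and of siblings.
\<close>

datatype 'a ptree = Node 'a "'a ptree list"

type_synonym 'a pforest = "'a ptree list"

fun preorder :: "'a ptree \<Rightarrow> 'a list" where
  "preorder (Node v ts) = v # concat (map preorder ts)"

fun subtrees :: "'a ptree \<Rightarrow> 'a ptree set" where
  "subtrees (Node v ts) = insert (Node v ts) (\<Union>t\<in>set ts. subtrees t)"

definition plane_forest :: "'a pforest \<Rightarrow> bool" where
  "plane_forest F \<longleftrightarrow> distinct (concat (map preorder F))"

definition verts :: "'a pforest \<Rightarrow> 'a set" where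
  "verts F = set (concat (map preorder F))"

text \<open>
  \<open>descendant F u v\<close>: \<open>u\<close> is a vertex of the subtree of \<open>F\<close> rooted at \<open>v\<close>; every vertex is a
  descendant of itself. So \<open>less_F\<close> and \<open>descendant\<close> are the strict and the reflexive order
  of the poset whose Hasse diagram is \<open>F\<close>, with the roots as maximal elements.
\<close>

definition descendant :: "'a pforest \<Rightarrow> 'a \<Rightarrow> 'a \<Rightarrow> bool" where
  "descendant F u v \<longleftrightarrow>
     (\<exists>t\<in>set F. \<exists>ts. Node v ts \<in> subtrees t \<and> u \<in> set (preorder (Node v ts)))"

definition less_F :: "'a pforest \<Rightarrow> 'a \<Rightarrow> 'a \<Rightarrow> bool" where
  "less_F F u v \<longleftrightarrow> u \<noteq> v \<and> descendant F u v"

definition hook :: "'a pforest \<Rightarrow> 'a \<Rightarrow> nat" where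
  "hook F v = card {u. descendant F u v}"


section \<open>Signed labelings and their statistics\<close>

text \<open>Labelings are extensional (\<open>undefined\<close> off \<open>verts F\<close>), so that each is counted once.\<close>

definition signed_labelings :: "'a pforest \<Rightarrow> ('a \<Rightarrow> int) set" where
  "signed_labelings F =
     {w \<in> verts F \<rightarrow>\<^sub>E ({- int (card (verts F))..int (card (verts F))} - {0}).
        inj_on w (verts F) \<and> (\<forall>i\<in>w ` verts F. - i \<notin> w ` verts F)}"

definition inv_F :: "'a pforest \<Rightarrow> ('a \<Rightarrow> int) \<Rightarrow> nat" where
  "inv_F F w = card {(u, v). less_F F u v \<and> w u > w v}"

definition n1 :: "'a pforest \<Rightarrow> ('a \<Rightarrow> int) \<Rightarrow> nat" where
  "n1 F w = card {v \<in> verts F. w v < 0}"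

definition n2 :: "'a pforest \<Rightarrow> ('a \<Rightarrow> int) \<Rightarrow> nat" where
  "n2 F w = card {(x, y). less_F F x y \<and> w x + w y < 0}"

definition inv_B :: "'a pforest \<Rightarrow> ('a \<Rightarrow> int) \<Rightarrow> nat" where
  "inv_B F w = inv_F F w + n1 F w + n2 F w"

definition Btmax_B :: "'a pforest \<Rightarrow> ('a \<Rightarrow> int) \<Rightarrow> 'a set" where
  "Btmax_B F w = {v \<in> verts F. w v > 0 \<and> (\<forall>u. less_F F u v \<longrightarrow> w v > \<bar>w u\<bar>)}"


section \<open>The polynomial ring\<close>

text \<open>
  Polynomials over the rationals in the commuting indeterminates \<open>p\<close>, \<open>q\<close> and \<open>t\<^sub>v\<close>: finitely
  supported maps from monomials (finitely supported exponent vectors) to coefficients, with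
  the convolution product.
\<close>

datatype 'a indet = Ind_p | Ind_q | Ind_t 'a

type_synonym 'a pqt_poly = "('a indet \<Rightarrow>\<^sub>0 nat) \<Rightarrow>\<^sub>0 rat"

definition X :: "'a indet \<Rightarrow> 'a pqt_poly" where
  "X x = Poly_Mapping.single (Poly_Mapping.single x 1) 1"

definition const_poly :: "rat \<Rightarrow> 'a pqt_poly" where
  "const_poly c = Poly_Mapping.single 0 c"

abbreviation p_ind :: "'a pqt_poly" where "p_ind \<equiv> X Ind_p"
abbreviation q_ind :: "'a pqt_poly" where "q_ind \<equiv> X Ind_q"
abbreviation t_ind :: "'a \<Rightarrow> 'a pqt_poly" where "t_ind v \<equiv> X (Ind_t v)"

definition q_int :: "nat \<Rightarrow> 'a pqt_poly" where
  "q_int m = (\<Sum>i<m. q_ind ^ i)"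

end

theory Submission
  imports Defs "HOL-Combinatorics.Transposition"
begin

text \<open>
  The weight of a signed labeling is a product of local factors, one for each vertex, and the
  local factors are independent.

  Locality: fix a vertex \<open>u\<close> with hook length \<open>h\<close> and let \<open>r\<close> be the rank of \<open>\<bar>w u\<bar>\<close> among the
  absolute values of the labels in the subtree of \<open>u\<close>. Attribute each pair counted by
  \<^const>\<open>inv_F\<close> or \<^const>\<open>n2\<close> to its upper vertex. If \<open>w u > 0\<close>, a descendant \<open>x\<close> contributes
  exactly when \<open>\<bar>w x\<bar> > w u\<close> (through \<^const>\<open>inv_F\<close> or \<^const>\<open>n2\<close> according to the sign of
  \<open>w x\<close>), which gives \<open>h - r\<close>. If \<open>w u < 0\<close>, each proper descendant contributes once, and once
  more if \<open>\<bar>w x\<bar> < \<bar>w u\<bar>\<close>; with the negative label itself this gives \<open>h + r - 1\<close>. Moreover \<open>u\<close>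
  lies in \<^const>\<open>Btmax_B\<close> exactly when \<open>w u > 0\<close> and \<open>r = h\<close>. So \<open>u\<close> contributes a factor that
  depends only on the sign of \<open>w u\<close> and on \<open>r\<close> (\<open>weight_eq_prod_vertex_factor\<close>), and the sum of
  this factor over both signs and all \<open>r \<in> {1..h}\<close> is \<open>(1 + p q\<^sup>h)[h] - 1 + t\<^sub>u\<close>
  (\<open>sum_vertex_factor\<close>).

  Independence: a signed labeling is a bijection \<open>\<sigma>\<close> onto \<open>{1..n}\<close> together with a set of vertices
  whose labels are negative (\<open>sum_signed_labelings\<close>), so for a given \<open>\<sigma>\<close> the sum over the signs
  factors over the vertices. It remains to see that for a uniformly random \<open>\<sigma>\<close> the ranks of the
  vertices in their subtrees are independent and uniform on \<open>{1..h}\<close> (\<open>sum_prod_ranks\<close>). This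
  follows from a symmetry: exchanging the label of \<open>v\<close> with the next larger label in the subtree
  of \<open>v\<close> raises the rank of \<open>v\<close> by one and leaves the rank of every other vertex unchanged
  (\<open>rank_swap_other\<close>, \<open>sum_rank_eq_Suc\<close>). Hence \<open>\<Prod>\<^sub>u h\<^sub>u\<close> times the sum equals \<open>n!\<close> times
  the product of the local sums; dividing by the hook product finishes the proof.
\<close>


section \<open>Ranks and labelings\<close>

definition rank :: "'a set \<Rightarrow> ('a \<Rightarrow> int) \<Rightarrow> 'a \<Rightarrow> nat" where
  "rank S \<sigma> v = card {u \<in> S. \<sigma> u \<le> \<sigma> v}"

lemma rank_less_iff:
  assumes "finite S" "x \<in> S" "y \<in> S"
  shows "rank S \<sigma> x < rank S \<sigma> y \<longleftrightarrow> \<sigma> x < \<sigma> y"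
proof
  assume "\<sigma> x < \<sigma> y"
  then have "{u \<in> S. \<sigma> u \<le> \<sigma> x} \<subset> {u \<in> S. \<sigma> u \<le> \<sigma> y}"
    using assms by (intro psubsetI subsetI notI) (auto dest: equalityD2[THEN subsetD, of _ _ y])
  then show "rank S \<sigma> x < rank S \<sigma> y"
    unfolding rank_def using assms by (simp add: psubset_card_mono)
next
  assume less: "rank S \<sigma> x < rank S \<sigma> y"
  show "\<sigma> x < \<sigma> y"
  proof (rule ccontr)
    assume "\<not> \<sigma> x < \<sigma> y"
    then have "rank S \<sigma> y \<le> rank S \<sigma> x"
      unfolding rank_def using assms by (intro card_mono) auto
    then show False using less by simp
  qed
qed

lemma bij_betw_rank:
  assumes "finite S" "inj_on \<sigma> S"
  shows "bij_betw (rank S \<sigma>) S {1..card S}"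
proof -
  have inj: "inj_on (rank S \<sigma>) S"
  proof (rule inj_onI)
    fix x y assume "x \<in> S" "y \<in> S" "rank S \<sigma> x = rank S \<sigma> y"
    then have "\<sigma> x = \<sigma> y"
      using rank_less_iff[OF assms(1), of x y \<sigma>] rank_less_iff[OF assms(1), of y x \<sigma>] by force
    then show "x = y" using \<open>x \<in> S\<close> \<open>y \<in> S\<close> assms(2) by (simp add: inj_on_eq_iff)
  qed
  have "rank S \<sigma> ` S \<subseteq> {1..card S}"
    using assms(1) by (auto simp: rank_def card_gt_0_iff Suc_le_eq intro: card_mono)
  moreover have "card (rank S \<sigma> ` S) = card S"
    by (simp add: inj card_image)
  ultimately have "rank S \<sigma> ` S = {1..card S}"
    by (intro card_subset_eq) auto
  with inj show ?thesis by (simp add: bij_betw_def)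
qed

text \<open>
  A permutation of the domain that maps \<open>S\<close> to itself carries the positions along with the labels.
\<close>

lemma rank_comp_transpose:
  assumes "a \<in> S \<longleftrightarrow> b \<in> S"
  shows "rank S (\<sigma> \<circ> transpose a b) x = rank S \<sigma> (transpose a b x)"
proof -
  have "transpose a b u \<in> S \<longleftrightarrow> u \<in> S" for u
    using assms by (simp add: transpose_def)
  then have "bij_betw (transpose a b)
      {u \<in> S. (\<sigma> \<circ> transpose a b) u \<le> (\<sigma> \<circ> transpose a b) x}
      {u \<in> S. \<sigma> u \<le> \<sigma> (transpose a b x)}"
    by (intro bij_betwI[where g = "transpose a b"]) auto
  then show ?thesis
    unfolding rank_def by (rule bij_betw_same_card)
qed

text \<open>
  In applications \<open>card L = card V\<close>, so that these are the bijections from \<open>V\<close> to \<open>L\<close>.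
\<close>

definition labelings :: "'a set \<Rightarrow> int set \<Rightarrow> ('a \<Rightarrow> int) set" where
  "labelings V L = {\<sigma> \<in> V \<rightarrow>\<^sub>E L. inj_on \<sigma> V}"

lemma finite_labelings:
  assumes "finite V" "finite L"
  shows "finite (labelings V L)"
  unfolding labelings_def using assms by (simp add: finite_PiE)

lemma card_labelings:
  assumes "finite V" "finite L" "card L = card V"
  shows "card (labelings V L) = fact (card V)"
  unfolding labelings_def
  using card_inj_on_subset_funcset[OF assms(1,2) order_refl] assms(3)
  by (simp add: fact_prod_rev atLeast0LessThan)

lemma labelings_comp_transpose:
  assumes "\<sigma> \<in> labelings V L" "a \<in> V" "b \<in> V"
  shows "\<sigma> \<circ> transpose a b \<in> labelings V L"
proof -
  have "transpose a b ` V = V" using assms by simp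
  moreover have "inj_on \<sigma> V" and E: "\<sigma> \<in> V \<rightarrow>\<^sub>E L" using assms(1) by (auto simp: labelings_def)
  ultimately have "inj_on (\<sigma> \<circ> transpose a b) V"
    by (intro comp_inj_on) auto
  moreover have "\<sigma> \<circ> transpose a b \<in> V \<rightarrow>\<^sub>E L"
    using E assms(2,3) by (auto simp: PiE_def extensional_def transpose_def Pi_def)
  ultimately show ?thesis by (simp add: labelings_def)
qed

section \<open>Independence of the ranks in a forest order\<close>

text \<open>
  The order-theoretic content of a forest: \<open>D v\<close> is the principal down-set of \<open>v\<close>, and two such
  sets are nested or disjoint. Laminarity is what makes a change inside \<open>D v\<close> invisible to all
  vertices that are neither above nor below \<open>v\<close>.
\<close>

locale forest_order =
  fixes V :: "'a set" and D :: "'a \<Rightarrow> 'a set"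
  assumes finite_V: "finite V"
    and self_in: "v \<in> V \<Longrightarrow> v \<in> D v"
    and D_subset: "v \<in> V \<Longrightarrow> D v \<subseteq> V"
    and D_mono: "v \<in> V \<Longrightarrow> u \<in> D v \<Longrightarrow> D u \<subseteq> D v"
    and D_antisym: "v \<in> V \<Longrightarrow> u \<in> D v \<Longrightarrow> v \<in> D u \<Longrightarrow> u = v"
    and D_laminar: "u \<in> V \<Longrightarrow> v \<in> V \<Longrightarrow> u \<in> D v \<or> v \<in> D u \<or> D u \<inter> D v = {}"
begin

lemma finite_D: "v \<in> V \<Longrightarrow> finite (D v)"
  using D_subset finite_V finite_subset by metis

text \<open>
  Let the labels of \<open>v\<close> and \<open>w\<close> be neighbours among the labels in \<open>D v\<close>, and exchange them. A
  proper descendant \<open>u\<close> of \<open>v\<close> does not have \<open>v\<close> in its own subtree, and no label of a third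
  vertex of \<open>D v\<close> separates the two labels, so all comparisons inside \<open>D u\<close> are unaffected. An
  ancestor of \<open>v\<close> sees only a permutation of the labels strictly below it. All other subtrees are
  disjoint from \<open>D v\<close>.
\<close>

lemma rank_swap_other:
  assumes v: "v \<in> V" and w: "w \<in> D v" and u: "u \<in> V" "u \<noteq> v"
    and inj: "inj_on \<sigma> V"
    and adj: "rank (D v) \<sigma> w = Suc (rank (D v) \<sigma> v) \<or> rank (D v) \<sigma> v = Suc (rank (D v) \<sigma> w)"
  shows "rank (D u) (\<sigma> \<circ> transpose v w) u = rank (D u) \<sigma> u"
proof -
  have vv: "v \<in> D v" by (rule self_in[OF v])
  have DV: "D v \<subseteq> V" by (rule D_subset[OF v])
  from D_laminar[OF u(1) v] consider "u \<in> D v" | "v \<in> D u" "u \<notin> D v" | "D u \<inter> D v = {}" by blast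
  then show ?thesis
  proof cases
    case 1
    have sub: "D u \<subseteq> D v" by (rule D_mono[OF v 1])
    have nv: "v \<notin> D u" using D_antisym[OF v 1] u by blast
    have same_side: "\<sigma> y < \<sigma> v \<longleftrightarrow> \<sigma> y < \<sigma> w" if "y \<in> D v" "y \<noteq> v" "y \<noteq> w" for y
    proof -
      have "\<sigma> y \<noteq> \<sigma> v" "\<sigma> y \<noteq> \<sigma> w"
        using inj that v w DV by (auto dest: inj_onD)
      moreover note less = rank_less_iff[OF finite_D[OF v], of _ _ \<sigma>]
      ultimately show ?thesis
        using less[OF that(1) vv] less[OF vv that(1)] less[OF that(1) w] less[OF w that(1)] adj
        by linarith
    qed
    have le: "\<sigma> y \<le> \<sigma> v \<longleftrightarrow> \<sigma> y \<le> \<sigma> w" "\<sigma> v \<le> \<sigma> y \<longleftrightarrow> \<sigma> w \<le> \<sigma> y"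
      if "y \<in> D v" "y \<noteq> v" "y \<noteq> w" for y
    proof -
      have "\<sigma> y \<noteq> \<sigma> v" "\<sigma> y \<noteq> \<sigma> w"
        using inj that v w DV by (auto dest: inj_onD)
      then show "\<sigma> y \<le> \<sigma> v \<longleftrightarrow> \<sigma> y \<le> \<sigma> w" "\<sigma> v \<le> \<sigma> y \<longleftrightarrow> \<sigma> w \<le> \<sigma> y"
        using same_side[OF that] by linarith+
    qed
    have "(\<sigma> \<circ> transpose v w) x \<le> (\<sigma> \<circ> transpose v w) u \<longleftrightarrow> \<sigma> x \<le> \<sigma> u" if "x \<in> D u" for x
    proof -
      have "x \<noteq> v" "x \<in> D v" using that nv sub by auto
      then show ?thesis
        using le[of x] le[of u] 1 u(2) by (auto simp: transpose_def)
    qed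
    then have "{x \<in> D u. (\<sigma> \<circ> transpose v w) x \<le> (\<sigma> \<circ> transpose v w) u} = {x \<in> D u. \<sigma> x \<le> \<sigma> u}"
      by blast
    then show ?thesis unfolding rank_def by (rule arg_cong)
  next
    case 2
    then have "w \<in> D u" using D_mono[OF u(1)] w by blast
    moreover have "u \<noteq> w" using 2 w by blast
    ultimately show ?thesis
      using 2 u(2) by (simp add: rank_comp_transpose)
  next
    case 3
    then have "v \<notin> D u" "w \<notin> D u" using vv w by auto
    moreover have "u \<noteq> w" using self_in[OF u(1)] calculation by auto
    ultimately show ?thesis
      using u(2) by (simp add: rank_comp_transpose)
  qed
qed

text \<open>
  The sums are split according to the vertex \<open>w\<close> of \<open>D v\<close> whose label is the neighbour of the
  label of \<open>v\<close>: rank \<open>k + 1\<close> on the left, rank \<open>k\<close> on the right. For fixed \<open>w\<close>, composition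
  with the transposition of \<open>v\<close> and \<open>w\<close> is an involution that exchanges the two classes.
\<close>

lemma sum_rank_eq_Suc:
  fixes \<Phi> :: "('a \<Rightarrow> int) \<Rightarrow> 'b::comm_monoid_add"
  assumes L: "finite L" and v: "v \<in> V" and k: "1 \<le> k" "k < card (D v)"
    and inv: "\<And>\<sigma> \<tau>. \<lbrakk>\<sigma> \<in> labelings V L; \<tau> \<in> labelings V L;
        \<And>u. u \<in> V - {v} \<Longrightarrow> rank (D u) \<sigma> u = rank (D u) \<tau> u\<rbrakk> \<Longrightarrow> \<Phi> \<sigma> = \<Phi> \<tau>"
  shows "(\<Sum>\<sigma> | \<sigma> \<in> labelings V L \<and> rank (D v) \<sigma> v = k. \<Phi> \<sigma>)
       = (\<Sum>\<sigma> | \<sigma> \<in> labelings V L \<and> rank (D v) \<sigma> v = Suc k. \<Phi> \<sigma>)"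
proof -
  let ?B = "labelings V L"
  have finB: "finite ?B" by (rule finite_labelings[OF finite_V L])
  have inj: "inj_on \<sigma> V" if "\<sigma> \<in> ?B" for \<sigma>
    using that by (simp add: labelings_def)
  have bij: "bij_betw (rank (D v) \<sigma>) (D v) {1..card (D v)}" if "\<sigma> \<in> ?B" for \<sigma>
    using bij_betw_rank[OF finite_D[OF v]] inj[OF that] D_subset[OF v] inj_on_subset by blast
  have split: "(\<Sum>\<sigma> | \<sigma> \<in> ?B \<and> rank (D v) \<sigma> v = i. \<Phi> \<sigma>)
      = (\<Sum>w\<in>D v. \<Sum>\<sigma> | \<sigma> \<in> ?B \<and> rank (D v) \<sigma> v = i \<and> rank (D v) \<sigma> w = j. \<Phi> \<sigma>)"
    if j: "j \<in> {1..card (D v)}" for i j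
  proof -
    let ?g = "\<lambda>\<sigma>. inv_into (D v) (rank (D v) \<sigma>) j"
    have g: "?g \<sigma> \<in> D v" "w \<in> D v \<Longrightarrow> ?g \<sigma> = w \<longleftrightarrow> rank (D v) \<sigma> w = j" if "\<sigma> \<in> ?B" for \<sigma> w
    proof -
      note b = bij[OF that]
      have im: "j \<in> rank (D v) \<sigma> ` D v" using b j by (simp add: bij_betw_def)
      then show "?g \<sigma> \<in> D v" by (rule inv_into_into)
      show "?g \<sigma> = w \<longleftrightarrow> rank (D v) \<sigma> w = j" if "w \<in> D v"
        using b im that by (metis bij_betw_def f_inv_into_f inv_into_f_f)
    qed
    let ?S = "{\<sigma> \<in> ?B. rank (D v) \<sigma> v = i}"
    have "(\<Sum>w\<in>D v. \<Sum>\<sigma> | \<sigma> \<in> ?S \<and> ?g \<sigma> = w. \<Phi> \<sigma>) = sum \<Phi> ?S"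
      using finB finite_D[OF v] g by (intro sum.group) auto
    moreover have "{\<sigma>. \<sigma> \<in> ?S \<and> ?g \<sigma> = w} = {\<sigma>. \<sigma> \<in> ?B \<and> rank (D v) \<sigma> v = i \<and> rank (D v) \<sigma> w = j}"
      if "w \<in> D v" for w
      using g(2)[OF _ that] by blast
    ultimately show ?thesis
      by simp
  qed
  have swap: "(\<Sum>\<sigma> | \<sigma> \<in> ?B \<and> rank (D v) \<sigma> v = k \<and> rank (D v) \<sigma> w = Suc k. \<Phi> \<sigma>)
      = (\<Sum>\<sigma> | \<sigma> \<in> ?B \<and> rank (D v) \<sigma> v = Suc k \<and> rank (D v) \<sigma> w = k. \<Phi> \<sigma>)"
    if w: "w \<in> D v" for w
  proof -
    let ?t = "\<lambda>\<sigma>. \<sigma> \<circ> transpose v w"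
    have wV: "w \<in> V" using w D_subset[OF v] by blast
    have r: "rank (D v) (?t \<sigma>) v = rank (D v) \<sigma> w" "rank (D v) (?t \<sigma>) w = rank (D v) \<sigma> v" for \<sigma>
      using self_in[OF v] w by (simp_all add: rank_comp_transpose)
    have B: "?t \<sigma> \<in> ?B" if "\<sigma> \<in> ?B" for \<sigma>
      by (rule labelings_comp_transpose[OF that v wV])
    have idem: "?t (?t \<sigma>) = \<sigma>" for \<sigma> :: "'a \<Rightarrow> int"
      by (simp add: comp_assoc)
    have Phi: "\<Phi> (?t \<sigma>) = \<Phi> \<sigma>"
      if "\<sigma> \<in> ?B" "rank (D v) \<sigma> v = k" "rank (D v) \<sigma> w = Suc k" for \<sigma>
      using that by (intro inv B) (auto intro!: rank_swap_other v w inj)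
    show ?thesis
      by (rule sum.reindex_bij_witness[of _ ?t ?t]) (auto simp only: mem_Collect_eq r B idem Phi)
  qed
  show ?thesis
    using split[of "Suc k" k] split[of k "Suc k"] swap k by simp
qed

text \<open>
  The vertices enter the product one at a time. For a new vertex \<open>v\<close>, let \<open>C k\<close> be the part of
  the sum of the previous product where \<open>v\<close> has rank \<open>k\<close>; by the swapping symmetry \<open>C k\<close> is the
  same for all \<open>k \<in> {1..card (D v)}\<close>. Thus the factor of \<open>v\<close> splits off as the sum of its values,
  against the \<open>card (D v)\<close> equal parts of the full sum. Multiplying by the cardinalities avoids
  division, which keeps the statement valid in every commutative semiring.
\<close>

theorem sum_prod_ranks:
  fixes g :: "'a \<Rightarrow> nat \<Rightarrow> 'b::comm_semiring_1"
  assumes L: "finite L" "card L = card V" and A: "A \<subseteq> V"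
  shows "(\<Prod>u\<in>A. of_nat (card (D u))) * (\<Sum>\<sigma>\<in>labelings V L. \<Prod>u\<in>A. g u (rank (D u) \<sigma> u))
       = of_nat (fact (card V)) * (\<Prod>u\<in>A. \<Sum>k=1..card (D u). g u k)"
  using finite_subset[OF A finite_V] A
proof (induction A rule: finite_induct)
  case empty
  then show ?case by (simp add: card_labelings[OF finite_V L])
next
  case (insert v A)
  let ?B = "labelings V L" and ?h = "card (D v)"
  define \<Phi> where "\<Phi> \<sigma> = (\<Prod>u\<in>A. g u (rank (D u) \<sigma> u))" for \<sigma>
  define C where "C k = (\<Sum>\<sigma> | \<sigma> \<in> ?B \<and> rank (D v) \<sigma> v = k. \<Phi> \<sigma>)" for k
  have v: "v \<in> V" and AV: "A \<subseteq> V" using insert.prems by auto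
  have finB: "finite ?B" by (rule finite_labelings[OF finite_V L(1)])
  have range: "rank (D v) \<sigma> v \<in> {1..?h}" if "\<sigma> \<in> ?B" for \<sigma>
  proof -
    have "inj_on \<sigma> (D v)"
      using that D_subset[OF v] by (auto simp: labelings_def intro: inj_on_subset)
    then show ?thesis
      using bij_betw_rank[OF finite_D[OF v]] self_in[OF v] by (metis bij_betwE)
  qed
  have step: "C k = C (Suc k)" if "1 \<le> k" "k < ?h" for k
    unfolding C_def
  proof (rule sum_rank_eq_Suc[OF L(1) v that])
    fix \<sigma> \<tau> assume "\<And>u. u \<in> V - {v} \<Longrightarrow> rank (D u) \<sigma> u = rank (D u) \<tau> u"
    moreover have "u \<in> V - {v}" if "u \<in> A" for u
      using that AV insert.hyps by blast
    ultimately show "\<Phi> \<sigma> = \<Phi> \<tau>"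
      unfolding \<Phi>_def by (intro prod.cong) simp_all
  qed
  have const: "C k = C 1" if "1 \<le> k" "k \<le> ?h" for k
    using that
  proof (induction k rule: dec_induct)
    case (step k)
    then show ?case using \<open>\<lbrakk>1 \<le> k; k < ?h\<rbrakk> \<Longrightarrow> C k = C (Suc k)\<close> by simp
  qed simp
  have group: "(\<Sum>\<sigma>\<in>?B. f (rank (D v) \<sigma> v) * \<Phi> \<sigma>) = (\<Sum>k=1..?h. f k) * C 1" for f
  proof -
    have "(\<Sum>\<sigma>\<in>?B. f (rank (D v) \<sigma> v) * \<Phi> \<sigma>)
        = (\<Sum>k=1..?h. \<Sum>\<sigma> | \<sigma> \<in> ?B \<and> rank (D v) \<sigma> v = k. f (rank (D v) \<sigma> v) * \<Phi> \<sigma>)"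
      using finB range by (intro sum.group[symmetric]) auto
    also have "\<dots> = (\<Sum>k=1..?h. f k * C k)"
      unfolding C_def sum_distrib_left by (intro sum.cong) auto
    also have "\<dots> = (\<Sum>k=1..?h. f k * C 1)"
    proof (rule sum.cong[OF refl])
      fix k assume "k \<in> {1..?h}"
      then show "f k * C k = f k * C 1" using const[of k] by simp
    qed
    finally show ?thesis by (simp only: sum_distrib_right)
  qed
  have total: "(\<Sum>\<sigma>\<in>?B. \<Phi> \<sigma>) = of_nat ?h * C 1"
    using group[of "\<lambda>_. 1"] by simp
  have "(\<Prod>u\<in>insert v A. of_nat (card (D u))) *
          (\<Sum>\<sigma>\<in>?B. \<Prod>u\<in>insert v A. g u (rank (D u) \<sigma> u))
      = (\<Prod>u\<in>A. of_nat (card (D u))) * of_nat ?h * ((\<Sum>k=1..?h. g v k) * C 1)"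
    using insert.hyps group[of "g v"] by (simp add: \<Phi>_def mult_ac)
  also have "\<dots> = (\<Sum>k=1..?h. g v k) * ((\<Prod>u\<in>A. of_nat (card (D u))) * (\<Sum>\<sigma>\<in>?B. \<Phi> \<sigma>))"
    unfolding total by (simp add: mult_ac)
  also have "\<dots> = (\<Sum>k=1..?h. g v k) *
      (of_nat (fact (card V)) * (\<Prod>u\<in>A. \<Sum>k=1..card (D u). g u k))"
    using insert.IH[OF AV] by (simp add: \<Phi>_def)
  finally show ?case
    using insert.hyps by (simp add: mult_ac)
qed

end

section \<open>The subtrees of a plane forest\<close>

definition vertex_subtrees :: "'a pforest \<Rightarrow> 'a ptree set" where
  "vertex_subtrees F = (\<Union>t\<in>set F. subtrees t)"

lemma subtrees_self: "t \<in> subtrees t"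
  by (cases t) simp

lemma set_preorder_subtree: "s \<in> subtrees t \<Longrightarrow> set (preorder s) \<subseteq> set (preorder t)"
  by (induction t) auto

lemma distinct_concat_map_memD: "distinct (concat (map f xs)) \<Longrightarrow> x \<in> set xs \<Longrightarrow> distinct (f x)"
  by (induction xs) auto

lemma distinct_preorder_subtree:
  "s \<in> subtrees t \<Longrightarrow> distinct (preorder t) \<Longrightarrow> distinct (preorder s)"
proof (induction t)
  case (Node v ts)
  then show ?case
    using distinct_concat_map_memD[of preorder ts] by fastforce
qed

lemma exists_subtree_at: "v \<in> set (preorder t) \<Longrightarrow> \<exists>ts. Node v ts \<in> subtrees t"
  by (induction t) fastforce

lemma distinct_concat_map_unique:
  "distinct (concat (map f xs)) \<Longrightarrow> x \<in> set xs \<Longrightarrow> y \<in> set xs \<Longrightarrow> z \<in> set (f x) \<Longrightarrow> z \<in> set (f y)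
    \<Longrightarrow> x = y"
  by (induction xs) auto

text \<open>
  Subtrees of different children of a vertex have no vertex in common because vertex names are
  distinct; subtrees of the same child are handled by induction.
\<close>

lemma subtrees_laminar:
  "distinct (preorder t) \<Longrightarrow> s \<in> subtrees t \<Longrightarrow> s' \<in> subtrees t
    \<Longrightarrow> s \<in> subtrees s' \<or> s' \<in> subtrees s \<or> set (preorder s) \<inter> set (preorder s') = {}"
proof (induction t)
  case (Node v ts)
  consider "s = Node v ts" | "s' = Node v ts"
    | c c' where "c \<in> set ts" "c' \<in> set ts" "s \<in> subtrees c" "s' \<in> subtrees c'"
    using Node.prems by auto
  then show ?case
  proof cases
    case 3
    have D: "distinct (concat (map preorder ts))" using Node.prems(1) by simp
    show ?thesis
    proof (cases "c = c'")
      case True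
      then show ?thesis
        using Node.IH[OF 3(1)] 3 distinct_concat_map_memD[OF D 3(1)] by blast
    next
      case False
      then show ?thesis
        using distinct_concat_map_unique[OF D 3(1,2)] set_preorder_subtree 3(3,4) by blast
    qed
  qed (use Node.prems in auto)
qed

lemma vertex_subtrees_laminar:
  assumes F: "plane_forest F" and s: "s \<in> vertex_subtrees F" "s' \<in> vertex_subtrees F"
  shows "s \<in> subtrees s' \<or> s' \<in> subtrees s \<or> set (preorder s) \<inter> set (preorder s') = {}"
proof -
  from s obtain c c' where c: "c \<in> set F" "c' \<in> set F" "s \<in> subtrees c" "s' \<in> subtrees c'"
    by (auto simp: vertex_subtrees_def)
  have D: "distinct (concat (map preorder F))" using F by (simp add: plane_forest_def)
  show ?thesis
  proof (cases "c = c'")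
    case True
    then show ?thesis
      using subtrees_laminar c distinct_concat_map_memD[OF D c(1)] by blast
  next
    case False
    then show ?thesis
      using distinct_concat_map_unique[OF D c(1,2)] set_preorder_subtree c(3,4) by blast
  qed
qed

lemma distinct_vertex_subtree:
  "plane_forest F \<Longrightarrow> s \<in> vertex_subtrees F \<Longrightarrow> distinct (preorder s)"
  unfolding plane_forest_def vertex_subtrees_def
  by (metis UN_E distinct_concat_map_memD distinct_preorder_subtree)

lemma proper_subtree_avoids_root:
  assumes "distinct (preorder (Node v ts))" "s \<in> subtrees (Node v ts)" "s \<noteq> Node v ts"
  shows "v \<notin> set (preorder s)"
  using assms set_preorder_subtree by fastforce

text \<open>
  Two subtrees with the same root intersect, so one contains the other, and a proper subtree
  cannot contain the root again. Thus a vertex determines its subtree, and the existential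
  quantifier over the list of children in \<^const>\<open>descendant\<close> is harmless.
\<close>

lemma vertex_subtree_unique:
  assumes F: "plane_forest F" and s: "Node v ts \<in> vertex_subtrees F" "Node v ts' \<in> vertex_subtrees F"
  shows "ts = ts'"
proof -
  have v: "v \<in> set (preorder (Node v ts))" "v \<in> set (preorder (Node v ts'))" by simp_all
  then have "set (preorder (Node v ts)) \<inter> set (preorder (Node v ts')) \<noteq> {}" by blast
  then consider "Node v ts \<in> subtrees (Node v ts')" | "Node v ts' \<in> subtrees (Node v ts)"
    using vertex_subtrees_laminar[OF F s] by blast
  then show ?thesis
  proof cases
    case 1
    then show ?thesis
      using proper_subtree_avoids_root[OF distinct_vertex_subtree[OF F s(2)] 1] v(1) by blast
  next
    case 2
    then show ?thesis
      using proper_subtree_avoids_root[OF distinct_vertex_subtree[OF F s(1)] 2] v(2) by blast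
  qed
qed

lemma subtrees_trans: "s \<in> subtrees t \<Longrightarrow> subtrees s \<subseteq> subtrees t"
  by (induction t) auto

lemma vertex_subtrees_closed:
  "t \<in> vertex_subtrees F \<Longrightarrow> s \<in> subtrees t \<Longrightarrow> s \<in> vertex_subtrees F"
  unfolding vertex_subtrees_def by (metis UN_iff subsetD subtrees_trans)

lemma in_verts_iff: "v \<in> verts F \<longleftrightarrow> (\<exists>ts. Node v ts \<in> vertex_subtrees F)"
proof
  assume "v \<in> verts F"
  then show "\<exists>ts. Node v ts \<in> vertex_subtrees F"
    unfolding verts_def vertex_subtrees_def using exists_subtree_at by fastforce
next
  assume "\<exists>ts. Node v ts \<in> vertex_subtrees F"
  then obtain ts t where "t \<in> set F" "Node v ts \<in> subtrees t"
    by (auto simp: vertex_subtrees_def)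
  then show "v \<in> verts F"
    unfolding verts_def using set_preorder_subtree[of "Node v ts" t] by auto
qed

lemma descendants_eq:
  assumes "plane_forest F" "Node v ts \<in> vertex_subtrees F"
  shows "{u. descendant F u v} = set (preorder (Node v ts))"
proof -
  have "descendant F u v \<longleftrightarrow> (\<exists>us. Node v us \<in> vertex_subtrees F \<and> u \<in> set (preorder (Node v us)))" for u
    unfolding descendant_def vertex_subtrees_def by blast
  then have "descendant F u v \<longleftrightarrow> u \<in> set (preorder (Node v ts))" for u
    using vertex_subtree_unique[OF assms(1) _ assms(2)] assms(2) by metis
  then show ?thesis by blast
qed

lemma descendant_in_verts: "descendant F u v \<Longrightarrow> v \<in> verts F"
  by (auto simp: descendant_def in_verts_iff vertex_subtrees_def)

lemma forest_order_descendants: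
  assumes F: "plane_forest F"
  shows "forest_order (verts F) (\<lambda>v. {u. descendant F u v})" (is "forest_order ?V ?D")
proof
  show "finite ?V" by (simp add: verts_def)
next
  fix v assume "v \<in> ?V"
  then obtain ts where ts: "Node v ts \<in> vertex_subtrees F" by (auto simp: in_verts_iff)
  note Dv = descendants_eq[OF F ts]
  show "v \<in> ?D v" unfolding Dv by simp
  have below: "\<exists>us. Node u us \<in> vertex_subtrees F \<and> Node u us \<in> subtrees (Node v ts)"
    if "u \<in> ?D v" for u
    using that exists_subtree_at vertex_subtrees_closed[OF ts] unfolding Dv by metis
  show "?D v \<subseteq> ?V"
  proof
    fix u assume "u \<in> ?D v"
    then show "u \<in> ?V" using below[of u] unfolding in_verts_iff by blast
  qed
  fix u assume u: "u \<in> ?D v"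
  then obtain us where us: "Node u us \<in> vertex_subtrees F" "Node u us \<in> subtrees (Node v ts)"
    using below[of u] by blast
  note Du = descendants_eq[OF F us(1)]
  show "?D u \<subseteq> ?D v" unfolding Du Dv by (rule set_preorder_subtree[OF us(2)])
  show "u = v" if "v \<in> ?D u"
    using that proper_subtree_avoids_root[OF distinct_vertex_subtree[OF F ts] us(2)]
    unfolding Du by auto
next
  fix u v assume "u \<in> ?V" "v \<in> ?V"
  then obtain us ts where
    us: "Node u us \<in> vertex_subtrees F" and ts: "Node v ts \<in> vertex_subtrees F"
    by (auto simp: in_verts_iff)
  have "u \<in> set (preorder (Node u us))" "v \<in> set (preorder (Node v ts))" by simp_all
  then show "u \<in> ?D v \<or> v \<in> ?D u \<or> ?D u \<inter> ?D v = {}"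
    unfolding descendants_eq[OF F us] descendants_eq[OF F ts]
    using vertex_subtrees_laminar[OF F us ts] set_preorder_subtree[of "Node u us" "Node v ts"]
      set_preorder_subtree[of "Node v ts" "Node u us"] by blast
qed

section \<open>The weight as a product over the vertices\<close>

text \<open>
  Pairs of comparable vertices are grouped by their upper vertex.
\<close>

lemma card_less_F_pairs:
  assumes F: "plane_forest F"
  shows "card {(u, v). less_F F u v \<and> P u v}
       = (\<Sum>v\<in>verts F. card {u \<in> {u. descendant F u v}. u \<noteq> v \<and> P u v})"
proof -
  interpret forest_order "verts F" "\<lambda>v. {u. descendant F u v}"
    by (rule forest_order_descendants[OF F])
  let ?S = "Sigma (verts F) (\<lambda>v. {u \<in> {u. descendant F u v}. u \<noteq> v \<and> P u v})"
  have "{(u, v). less_F F u v \<and> P u v} = prod.swap ` ?S"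
    using descendant_in_verts by (force simp: less_F_def image_iff)
  then have "card {(u, v). less_F F u v \<and> P u v} = card ?S"
    by (simp add: card_image inj_on_def)
  also have "\<dots> = (\<Sum>v\<in>verts F. card {u \<in> {u. descendant F u v}. u \<noteq> v \<and> P u v})"
    using finite_V finite_D by (intro card_SigmaI) auto
  finally show ?thesis .
qed

text \<open>
  Write \<open>A\<close> and \<open>B\<close> for the two sets and use \<open>card A + card B = card (A \<union> B) + card (A \<inter> B)\<close>.
  For \<open>w u > 0\<close> the sets are disjoint with union \<open>{x. \<bar>w x\<bar> > \<bar>w u\<bar>}\<close>. For \<open>w u < 0\<close> their union
  is \<open>S - {u}\<close> and their intersection is \<open>{x. \<bar>w x\<bar> < \<bar>w u\<bar>}\<close>, of cardinality \<open>r - 1\<close>.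
\<close>

lemma vertex_contribution:
  fixes w :: "'a \<Rightarrow> int"
  assumes S: "finite S" "u \<in> S" and w0: "w u \<noteq> 0" and inj: "inj_on (\<lambda>x. \<bar>w x\<bar>) S"
  defines "r \<equiv> rank S (\<lambda>x. \<bar>w x\<bar>) u"
  shows "card {x \<in> S. x \<noteq> u \<and> w x > w u} + (if w u < 0 then 1 else 0)
         + card {x \<in> S. x \<noteq> u \<and> w x + w u < 0}
       = (if w u < 0 then card S + r - 1 else card S - r)"
proof -
  let ?A = "{x \<in> S. x \<noteq> u \<and> w x > w u}" and ?B = "{x \<in> S. x \<noteq> u \<and> w x + w u < 0}"
  let ?R = "{x \<in> S. \<bar>w x\<bar> \<le> \<bar>w u\<bar>}"
  have r: "r = card ?R" by (simp add: r_def rank_def)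
  have sum: "card ?A + card ?B = card (?A \<union> ?B) + card (?A \<inter> ?B)"
    using S by (intro card_Un_Int) auto
  have uR: "u \<in> ?R" using S by simp
  have ne: "\<bar>w x\<bar> \<noteq> \<bar>w u\<bar>" if "x \<in> S" "x \<noteq> u" for x
    using that inj S(2) by (auto dest: inj_onD)
  show ?thesis
  proof (cases "w u < 0")
    case True
    have "?A \<union> ?B = S - {u}" using True by auto
    moreover have "?A \<inter> ?B = ?R - {u}"
      using True ne by force
    moreover have "card S \<ge> 1" "card ?R \<ge> 1"
      using S uR by (simp_all add: Suc_le_eq card_gt_0_iff) blast+
    ultimately show ?thesis
      using True sum S uR r by (simp add: card_Diff_singleton)
  next
    case False
    then have "?A \<union> ?B = S - ?R" "?A \<inter> ?B = {}" using w0 by auto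
    moreover have "card (S - ?R) = card S - card ?R"
      using S by (intro card_Diff_subset) auto
    ultimately show ?thesis using False sum r by simp
  qed
qed

text \<open>
  For the absolute values of the labels, this recognises the vertices of \<^const>\<open>Btmax_B\<close> among
  those with a positive label.
\<close>

lemma rank_eq_card_iff:
  assumes S: "finite S" "u \<in> S" and inj: "inj_on \<sigma> S"
  shows "rank S \<sigma> u = card S \<longleftrightarrow> (\<forall>x\<in>S. x \<noteq> u \<longrightarrow> \<sigma> x < \<sigma> u)"
proof -
  have "rank S \<sigma> u = card S \<longleftrightarrow> {x \<in> S. \<sigma> x \<le> \<sigma> u} = S"
    unfolding rank_def using S(1) by (metis (no_types, lifting) card_subset_eq mem_Collect_eq subsetI)
  also have "\<dots> \<longleftrightarrow> (\<forall>x\<in>S. x \<noteq> u \<longrightarrow> \<sigma> x < \<sigma> u)"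
    using inj S(2) by (auto simp: le_less dest: inj_onD)
  finally show ?thesis .
qed

text \<open>
  The contribution of a vertex \<open>u\<close> with hook length \<open>h\<close> whose label has rank \<open>r\<close> in absolute
  value; \<open>neg\<close> tells whether the label is negative. For a positive label of rank \<open>h\<close> the power of
  \<open>q\<close> is \<open>q\<^sup>0\<close>.
\<close>

definition vertex_factor :: "'a \<Rightarrow> nat \<Rightarrow> nat \<Rightarrow> bool \<Rightarrow> 'a pqt_poly" where
  "vertex_factor u h r neg =
     (if neg then p_ind * q_ind ^ (h + r - 1) else if r = h then t_ind u else q_ind ^ (h - r))"

lemma weight_eq_prod_vertex_factor:
  fixes F :: "'a pforest" and w :: "'a \<Rightarrow> int"
  assumes F: "plane_forest F"
    and w0: "\<And>u. u \<in> verts F \<Longrightarrow> w u \<noteq> 0" and inj: "inj_on (\<lambda>u. \<bar>w u\<bar>) (verts F)"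
  shows "p_ind ^ n1 F w * q_ind ^ inv_B F w * (\<Prod>u\<in>Btmax_B F w. t_ind u)
       = (\<Prod>u\<in>verts F. vertex_factor u (hook F u)
            (rank {x. descendant F x u} (\<lambda>x. \<bar>w x\<bar>) u) (w u < 0))"
proof -
  interpret forest_order "verts F" "\<lambda>v. {u. descendant F u v}"
    by (rule forest_order_descendants[OF F])
  let ?V = "verts F" and ?D = "\<lambda>v. {u. descendant F u v}"
  let ?r = "\<lambda>u. rank (?D u) (\<lambda>x. \<bar>w x\<bar>) u"
  define c where "c u = (if w u < 0 then hook F u + ?r u - 1 else hook F u - ?r u)" for u
  have injD: "inj_on (\<lambda>x. \<bar>w x\<bar>) (?D u)" if "u \<in> ?V" for u
    using inj D_subset[OF that] by (rule inj_on_subset)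
  have n1: "n1 F w = (\<Sum>u\<in>?V. if w u < 0 then 1 else 0)"
    unfolding n1_def using finite_V by (simp add: sum.If_cases Int_def)
  have "inv_B F w = (\<Sum>u\<in>?V. card {x \<in> ?D u. x \<noteq> u \<and> w x > w u} + (if w u < 0 then 1 else 0)
      + card {x \<in> ?D u. x \<noteq> u \<and> w x + w u < 0})"
    unfolding inv_B_def inv_F_def n2_def n1 card_less_F_pairs[OF F] by (simp only: sum.distrib)
  also have "\<dots> = (\<Sum>u\<in>?V. c u)"
    unfolding c_def hook_def
    by (intro sum.cong refl vertex_contribution finite_D self_in w0 injD)
  finally have inv: "inv_B F w = (\<Sum>u\<in>?V. c u)" .
  have Bt: "Btmax_B F w = {u \<in> ?V. \<not> w u < 0 \<and> ?r u = hook F u}"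
  proof -
    have "w u > 0 \<and> (\<forall>x. less_F F x u \<longrightarrow> w u > \<bar>w x\<bar>) \<longleftrightarrow> \<not> w u < 0 \<and> ?r u = hook F u"
      if u: "u \<in> ?V" for u
      using rank_eq_card_iff[OF finite_D[OF u] self_in[OF u] injD[OF u]] w0[OF u]
      by (auto simp: hook_def less_F_def)
    then show ?thesis unfolding Btmax_B_def by blast
  qed
  have p: "p_ind ^ n1 F w = (\<Prod>u\<in>?V. if w u < 0 then p_ind else 1 :: 'a pqt_poly)"
    unfolding n1 power_sum by (rule prod.cong) auto
  have q: "q_ind ^ inv_B F w = (\<Prod>u\<in>?V. q_ind ^ c u :: 'a pqt_poly)"
    unfolding inv by (rule power_sum)
  have t: "(\<Prod>u\<in>Btmax_B F w. t_ind u)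
      = (\<Prod>u\<in>?V. if \<not> w u < 0 \<and> ?r u = hook F u then t_ind u else 1 :: 'a pqt_poly)"
    unfolding Bt by (rule prod.inter_filter[OF finite_V])
  show ?thesis
    unfolding p q t prod.distrib[symmetric]
    by (rule prod.cong) (auto simp: vertex_factor_def c_def)
qed

section \<open>Signed labelings as labelings with a set of negative vertices\<close>

definition attach_signs :: "'a set \<Rightarrow> ('a \<Rightarrow> int) \<Rightarrow> 'a set \<Rightarrow> 'a \<Rightarrow> int" where
  "attach_signs V \<sigma> N = (\<lambda>v\<in>V. if v \<in> N then - \<sigma> v else \<sigma> v)"

text \<open>
  Equal absolute values mean equal or opposite labels. The case \<open>i = 0\<close> of the right-hand side
  excludes the label \<open>0\<close>, since \<open>- 0 = 0\<close>.
\<close>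

lemma inj_on_abs_iff_signed:
  fixes w :: "'a \<Rightarrow> int"
  shows "inj_on (\<lambda>v. \<bar>w v\<bar>) V \<and> (\<forall>v\<in>V. w v \<noteq> 0)
     \<longleftrightarrow> inj_on w V \<and> (\<forall>i\<in>w ` V. - i \<notin> w ` V)"
proof safe
  assume inj: "inj_on (\<lambda>v. \<bar>w v\<bar>) V" and nz: "\<forall>v\<in>V. w v \<noteq> 0"
  show "inj_on w V" using inj by (auto simp: inj_on_def)
  fix v v' assume "v \<in> V" "v' \<in> V" "- w v = w v'"
  moreover from this have "v = v'" using inj by (metis abs_minus_cancel inj_onD)
  ultimately show False using nz by auto
next
  assume inj: "inj_on w V" and neg: "\<forall>i\<in>w ` V. - i \<notin> w ` V"
  show "inj_on (\<lambda>v. \<bar>w v\<bar>) V"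
  proof (rule inj_onI)
    fix x y assume xy: "x \<in> V" "y \<in> V" "\<bar>w x\<bar> = \<bar>w y\<bar>"
    then have "w x = w y \<or> - w x = w y" by linarith
    then show "x = y" using xy inj neg by (metis image_eqI inj_onD)
  qed
  show False if "v \<in> V" "w v = 0" for v using neg that by force
qed

lemma signed_labelings_eq:
  "signed_labelings F = {w \<in> extensional (verts F).
     (\<forall>v\<in>verts F. \<bar>w v\<bar> \<in> {1..int (card (verts F))}) \<and> inj_on (\<lambda>v. \<bar>w v\<bar>) (verts F)}"
proof -
  have "w \<in> signed_labelings F \<longleftrightarrow> w \<in> extensional (verts F) \<and>
     (\<forall>v\<in>verts F. \<bar>w v\<bar> \<in> {1..int (card (verts F))}) \<and> inj_on (\<lambda>v. \<bar>w v\<bar>) (verts F)" for w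
    using inj_on_abs_iff_signed[of w "verts F"]
    by (auto simp: signed_labelings_def PiE_iff abs_le_iff) (smt (verit))+
  then show ?thesis by blast
qed

text \<open>
  The inverse of attaching signs takes absolute values and records where the label is negative.
\<close>

lemma sum_signed_labelings:
  fixes F :: "'a pforest"
  defines "V \<equiv> verts F"
  shows "(\<Sum>w\<in>signed_labelings F. f w)
       = (\<Sum>\<sigma>\<in>labelings V {1..int (card V)}. \<Sum>N\<in>Pow V. f (attach_signs V \<sigma> N))"
proof -
  let ?L = "labelings V {1..int (card V)}"
  have "(\<Sum>w\<in>signed_labelings F. f w) = (\<Sum>(\<sigma>, N)\<in>?L \<times> Pow V. f (attach_signs V \<sigma> N))"
  proof (rule sum.reindex_bij_witness
      [of _ "\<lambda>(\<sigma>, N). attach_signs V \<sigma> N" "\<lambda>w. (\<lambda>v\<in>V. \<bar>w v\<bar>, {v \<in> V. w v < 0})"])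
    fix w assume "w \<in> signed_labelings F"
    then have w: "w \<in> extensional V" "\<And>v. v \<in> V \<Longrightarrow> \<bar>w v\<bar> \<in> {1..int (card V)}"
      "inj_on (\<lambda>v. \<bar>w v\<bar>) V"
      by (auto simp: signed_labelings_eq V_def)
    show eq: "(case (\<lambda>v\<in>V. \<bar>w v\<bar>, {v \<in> V. w v < 0}) of (\<sigma>, N) \<Rightarrow> attach_signs V \<sigma> N) = w"
      using w(1) by (auto simp: attach_signs_def extensional_def)
    then show "(case (\<lambda>v\<in>V. \<bar>w v\<bar>, {v \<in> V. w v < 0}) of (\<sigma>, N) \<Rightarrow> f (attach_signs V \<sigma> N)) = f w"
      by simp
    show "(\<lambda>v\<in>V. \<bar>w v\<bar>, {v \<in> V. w v < 0}) \<in> ?L \<times> Pow V"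
      using w(2,3) by (auto simp: labelings_def inj_on_def)
  next
    fix x assume "x \<in> ?L \<times> Pow V"
    then obtain \<sigma> N where x: "x = (\<sigma>, N)" and N: "N \<subseteq> V" and L: "\<sigma> \<in> ?L"
      by auto
    from L have \<sigma>: "\<sigma> \<in> extensional V" "\<And>v. v \<in> V \<Longrightarrow> \<sigma> v \<in> {1..int (card V)}" "inj_on \<sigma> V"
      unfolding labelings_def PiE_def Pi_def by blast+
    have pos: "0 < \<sigma> v" if "v \<in> V" for v using \<sigma>(2)[OF that] by simp
    have abs: "\<bar>attach_signs V \<sigma> N v\<bar> = \<sigma> v" if "v \<in> V" for v
      using that pos[OF that] by (simp add: attach_signs_def)
    have neg: "attach_signs V \<sigma> N v < 0 \<longleftrightarrow> v \<in> N" if "v \<in> V" for v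
      using that pos[OF that] by (simp add: attach_signs_def)
    have "(\<lambda>v\<in>V. \<bar>attach_signs V \<sigma> N v\<bar>) = \<sigma>"
      using abs \<sigma>(1) by (auto simp: extensional_def)
    moreover have "{v \<in> V. attach_signs V \<sigma> N v < 0} = N"
      using neg N by blast
    ultimately show "(\<lambda>v\<in>V. \<bar>(case x of (\<sigma>, N) \<Rightarrow> attach_signs V \<sigma> N) v\<bar>,
        {v \<in> V. (case x of (\<sigma>, N) \<Rightarrow> attach_signs V \<sigma> N) v < 0}) = x"
      by (simp add: x)
    have "inj_on (\<lambda>v. \<bar>attach_signs V \<sigma> N v\<bar>) V"
      using \<sigma>(3) abs by (simp add: inj_on_def)
    moreover have "attach_signs V \<sigma> N \<in> extensional V" by (simp add: attach_signs_def)
    ultimately show "(case x of (\<sigma>, N) \<Rightarrow> attach_signs V \<sigma> N) \<in> signed_labelings F"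
      using abs \<sigma>(2) by (simp add: x signed_labelings_eq V_def)
  qed
  then show ?thesis by (simp add: sum.cartesian_product)
qed

section \<open>The generating function\<close>

text \<open>
  The negative labels give \<open>p q\<^sup>h (1 + q + \<cdots> + q\<^bsup>h-1\<^esup>)\<close>. The positive ones give
  \<open>q\<^bsup>h-1\<^esup> + \<cdots> + q + 1\<close> with the last term, belonging to \<open>r = h\<close>, replaced by \<open>t\<^sub>u\<close>.
\<close>

lemma sum_vertex_factor:
  assumes "h \<ge> 1"
  shows "(\<Sum>r=1..h. vertex_factor u h r True + vertex_factor u h r False)
       = (1 + p_ind * q_ind ^ h) * q_int h - 1 + t_ind u"
proof -
  obtain m where h: "h = Suc m" using assms by (cases h) auto
  have "(\<Sum>r=1..h. vertex_factor u h r True) = p_ind * q_ind ^ h * q_int h"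
    unfolding One_nat_def sum.atLeast1_atMost_eq vertex_factor_def q_int_def
    by (simp only: if_True add_Suc_right diff_Suc_Suc diff_zero sum_distrib_left power_add mult.assoc)
  moreover have "(\<Sum>r=1..h. vertex_factor u h r False) = q_int h - 1 + t_ind u"
  proof -
    have "(\<Sum>r=1..h. vertex_factor u h r False) = (\<Sum>k<m. q_ind ^ (m - k)) + t_ind u"
      unfolding One_nat_def sum.atLeast1_atMost_eq h by (simp add: vertex_factor_def)
    also have "(\<Sum>k<m. q_ind ^ (m - k)) = (\<Sum>k<m. q_ind ^ Suc (m - Suc k) :: 'a pqt_poly)"
      by (rule sum.cong) (auto simp: Suc_diff_Suc)
    also have "\<dots> = (\<Sum>k<m. q_ind ^ Suc k)"
      by (rule sum.nat_diff_reindex)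
    also have "\<dots> = q_int h - 1"
      unfolding q_int_def h sum.lessThan_Suc_shift by simp
    finally show ?thesis .
  qed
  ultimately show ?thesis by (simp add: sum.distrib algebra_simps)
qed

lemma const_poly_mult_cancel:
  fixes S P :: "'a pqt_poly"
  assumes "of_nat b * S = of_nat a * P" "b > 0"
  shows "S = const_poly (of_nat a / of_nat b) * P"
proof -
  have of_nat: "of_nat m = (const_poly (of_nat m) :: 'a pqt_poly)" for m
    by (simp add: const_poly_def)
  have mult: "const_poly x * const_poly y = (const_poly (x * y) :: 'a pqt_poly)" for x y
    by (simp add: const_poly_def mult_single)
  have one: "const_poly 1 = (1 :: 'a pqt_poly)"
    by (simp add: const_poly_def)
  have "S = const_poly (1 / of_nat b) * (of_nat b * S)"
    using assms(2) by (simp add: of_nat mult mult.assoc[symmetric] one del: single_of_nat)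
  also have "\<dots> = const_poly (of_nat a / of_nat b) * P"
    unfolding assms(1) by (simp add: of_nat mult mult.assoc[symmetric] del: single_of_nat)
  finally show ?thesis .
qed

theorem theorem2p6:
  fixes F :: "'a pforest" and n :: nat and v :: "nat \<Rightarrow> 'a"
  assumes "plane_forest F"
    and "n \<ge> 1"
    and "bij_betw v {1..n} (verts F)"
    and "\<And>i j. i \<in> {1..n} \<Longrightarrow> j \<in> {1..n} \<Longrightarrow> less_F F (v i) (v j) \<Longrightarrow> i < j"
  shows "(\<Sum>w\<in>signed_labelings F.
            p_ind ^ n1 F w * q_ind ^ inv_B F w * (\<Prod>u\<in>Btmax_B F w. t_ind u))
         = const_poly (fact n / of_nat (\<Prod>u\<in>verts F. hook F u)) *
           (\<Prod>u\<in>verts F.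
              (1 + p_ind * q_ind ^ hook F u) * q_int (hook F u) - 1 + t_ind u)"
proof -
  interpret forest_order "verts F" "\<lambda>v. {u. descendant F u v}"
    by (rule forest_order_descendants[OF assms(1)])
  let ?V = "verts F" and ?D = "\<lambda>v. {u. descendant F u v}"
  let ?B = "labelings ?V {1..int (card ?V)}"
  let ?wt = "\<lambda>w. p_ind ^ n1 F w * q_ind ^ inv_B F w * (\<Prod>u\<in>Btmax_B F w. t_ind u) :: 'a pqt_poly"
  let ?f = "\<lambda>u r neg. vertex_factor u (hook F u) r neg"
  define g where "g u r = ?f u r True + ?f u r False" for u r
  have n: "card ?V = n" using bij_betw_same_card[OF assms(3)] by simp
  have hook_pos: "hook F u \<ge> 1" if "u \<in> ?V" for u
    unfolding hook_def using finite_D[OF that] self_in[OF that]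
    by (metis One_nat_def Suc_leI card_gt_0_iff empty_iff)
  \<comment> \<open>for fixed absolute values, the set of negative vertices selects one of two factors at each vertex\<close>
  have wt: "?wt (attach_signs ?V \<sigma> N)
      = (\<Prod>u\<in>N. ?f u (rank (?D u) \<sigma> u) True) * (\<Prod>u\<in>?V - N. ?f u (rank (?D u) \<sigma> u) False)"
    if \<sigma>: "\<sigma> \<in> ?B" and N: "N \<in> Pow ?V" for \<sigma> N
  proof -
    have pos: "0 < \<sigma> u" if "u \<in> ?V" for u using \<sigma> that by (force simp: labelings_def)
    have inj: "inj_on \<sigma> ?V" using \<sigma> by (simp add: labelings_def)
    let ?w = "attach_signs ?V \<sigma> N"
    have abs: "\<bar>?w u\<bar> = \<sigma> u" if "u \<in> ?V" for u
      using that pos[OF that] by (simp add: attach_signs_def)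
    have neg: "?w u < 0 \<longleftrightarrow> u \<in> N" if "u \<in> ?V" for u
      using that pos[OF that] by (simp add: attach_signs_def)
    have rank: "rank (?D u) (\<lambda>x. \<bar>?w x\<bar>) u = rank (?D u) \<sigma> u" if "u \<in> ?V" for u
    proof -
      have "{x \<in> ?D u. \<bar>?w x\<bar> \<le> \<bar>?w u\<bar>} = {x \<in> ?D u. \<sigma> x \<le> \<sigma> u}"
        using abs D_subset[OF that] that by (metis (no_types, lifting) subsetD)
      then show ?thesis by (simp add: rank_def)
    qed
    have "?wt ?w = (\<Prod>u\<in>?V. ?f u (rank (?D u) (\<lambda>x. \<bar>?w x\<bar>) u) (?w u < 0))"
    proof (rule weight_eq_prod_vertex_factor[OF assms(1)])
      show "?w u \<noteq> 0" if "u \<in> ?V" for u using abs[OF that] pos[OF that] by auto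
      show "inj_on (\<lambda>u. \<bar>?w u\<bar>) ?V" using inj abs by (simp add: inj_on_def)
    qed
    also have "\<dots> = (\<Prod>u\<in>?V. ?f u (rank (?D u) \<sigma> u) (u \<in> N))"
      by (rule prod.cong) (simp_all only: rank neg)
    also have "\<dots> = (\<Prod>u\<in>?V - N. ?f u (rank (?D u) \<sigma> u) (u \<in> N)) * (\<Prod>u\<in>N. ?f u (rank (?D u) \<sigma> u) (u \<in> N))"
      using N finite_V by (intro prod.subset_diff) auto
    finally show ?thesis by (simp add: mult.commute)
  qed
  have "(\<Sum>w\<in>signed_labelings F. ?wt w) = (\<Sum>\<sigma>\<in>?B. \<Sum>N\<in>Pow ?V. ?wt (attach_signs ?V \<sigma> N))"
    by (rule sum_signed_labelings)
  \<comment> \<open>the sum over all sets of negative vertices is the expansion of a product of binomials\<close>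
  also have "\<dots> = (\<Sum>\<sigma>\<in>?B. \<Prod>u\<in>?V. g u (rank (?D u) \<sigma> u))"
    unfolding g_def prod_add[OF finite_V] by (intro sum.cong refl wt)
  finally have sum: "(\<Sum>w\<in>signed_labelings F. ?wt w) = (\<Sum>\<sigma>\<in>?B. \<Prod>u\<in>?V. g u (rank (?D u) \<sigma> u))" .
  have "of_nat (\<Prod>u\<in>?V. hook F u) * (\<Sum>w\<in>signed_labelings F. ?wt w)
      = of_nat (fact n) * (\<Prod>u\<in>?V. \<Sum>k=1..hook F u. g u k)"
    using sum_prod_ranks[of "{1..int (card ?V)}" ?V g]
    by (simp add: sum hook_def of_nat_prod n)
  also have "(\<Prod>u\<in>?V. \<Sum>k=1..hook F u. g u k)
      = (\<Prod>u\<in>?V. (1 + p_ind * q_ind ^ hook F u) * q_int (hook F u) - 1 + t_ind u)"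
    unfolding g_def by (intro prod.cong refl sum_vertex_factor hook_pos)
  finally have "(\<Sum>w\<in>signed_labelings F. ?wt w)
      = const_poly (of_nat (fact n) / of_nat (\<Prod>u\<in>?V. hook F u)) *
        (\<Prod>u\<in>?V. (1 + p_ind * q_ind ^ hook F u) * q_int (hook F u) - 1 + t_ind u)"
    by (rule const_poly_mult_cancel) (use hook_pos in \<open>force intro: prod_pos\<close>)
  then show ?thesis by simp
qed

end
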